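(* Let $q$ be an odd prime power, and let $T=\left\{\begin{pmatrix}1&x\\0&1\end{pmatrix} : x\in\mathbb F_q\right\}\le \mathrm{SL}(2,q)$. Let $\mathbb F_q^\square$ be the set of squares in $\mathbb F_q$ (including $0$), let $\Omega=\{g\in \mathrm{SL}(2,q) : (0,1)\,g\,(1,0)^{\mathsf T}\in\mathbb F_q^\square\}$ (i.e. the lower-left entry of $g$ is a square) and $\Omega^{\mathsf c}=\mathrm{SL}(2,q)\smallsetminus\Omega$. Put $A=\{Tg : g\in\Omega\}\cup\{gT : g\in\Omega^{\mathsf c}\}$, $A'=\{Tg : g\in\Omega^{\mathsf c}\}\cup\{gT : g\in\Omega\}$, and for $h\in\mathrm{SL}(2,q)$ let $A^h=\{h^{-1}Xh : X\in A\}$, $A'^h=\{h^{-1}Xh: X\in A'\}$. Define $\pi_{\mathsf{odd}}=\{A^h : h\in \mathrm{SL}(2,q)\}$ and $\pi'_{\mathsf{odd}}=\{A'^h : h\in\mathrm{SL}(2,q)\}$. Then $\pi_{\mathsf{odd}}$ and $\pi'_{\mathsf{odd}}$ are parallelisms on $\mathfrak S$. Moreover, if $v\in\mathbb F_q^\times$ is a non-square and $f=\begin{pmatrix}1&0\\0&v\end{pmatrix}$, then conjugation by $f$ maps $\pi_{\mathsf{odd}}$ to $\pi'_{\mathsf{odd}}$, i.e. $\{\{f^{-1}Xf : X\in B\} : B\in\pi_{\mathsf{odd}}\}=\pi'_{\mathsf{odd}}$.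
   Context: $p$ is a prime and $q$ a power of $p$. $\mathfrak P$ denotes the set of Sylow $p$-subgroups of $\mathrm{SL}(2,q)$ and $\mathfrak S=\{Pg : P\in\mathfrak P,\ g\in\mathrm{SL}(2,q)\}$ the set of all right cosets of Sylow $p$-subgroups (note every left coset $gP$ is the right coset $P^{g^{-1}}g$ of a conjugate). A parallelism on $\mathfrak S$ is a partition of $\mathfrak S$ into $q+1$ sets, each consisting of $q^2-1$ pairwise disjoint cosets. *)

theory Defs
  imports
    "HOL-Algebra.Coset"
    "HOL-Analysis.Determinants"
    "HOL-Computational_Algebra.Primes"
    "HOL-Library.Disjoint_Sets"
begin

definition SL2 :: "('a::field ^ 2 ^ 2) monoid" where
  "SL2 = \<lparr>carrier = {g. det g = 1}, monoid.mult = (**), one = mat 1\<rparr>"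

lemma group_SL2: "group (SL2 :: ('a::field ^ 2 ^ 2) monoid)"
proof (rule groupI)
  fix g :: "'a ^ 2 ^ 2"
  assume "g \<in> carrier SL2"
  then have d: "det g = 1"
    by (simp add: SL2_def)
  then have "invertible g"
    by (simp add: invertible_det_nz)
  then obtain h where h: "h ** g = mat 1"
    by (auto simp: invertible_def)
  have "det h * det g = 1"
    by (metis h det_mul det_I)
  with d h show "\<exists>h\<in>carrier SL2. h \<otimes>\<^bsub>SL2\<^esub> g = \<one>\<^bsub>SL2\<^esub>"
    by (auto simp: SL2_def)
qed (auto simp: SL2_def det_mul matrix_mul_assoc)

definition sylow_subgroups :: "nat \<Rightarrow> ('g, 'm) monoid_scheme \<Rightarrow> 'g set set" where
  "sylow_subgroups p G = {P. subgroup P G \<and> card P = p ^ multiplicity p (order G)}"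

definition sylow_cosets :: "nat \<Rightarrow> ('g, 'm) monoid_scheme \<Rightarrow> 'g set set" where
  "sylow_cosets p G = {P #>\<^bsub>G\<^esub> g | P g. P \<in> sylow_subgroups p G \<and> g \<in> carrier G}"

definition parallelism_on :: "nat \<Rightarrow> 'g set set \<Rightarrow> 'g set set set \<Rightarrow> bool" where
  "parallelism_on q S \<pi> \<longleftrightarrow>
     partition_on S \<pi> \<and> card \<pi> = q + 1 \<and>
     (\<forall>B\<in>\<pi>. card B = q ^ 2 - 1 \<and> pairwise disjnt B)"

definition T :: "('a::field ^ 2 ^ 2) set" where
  "T = {vector [vector [1, x], vector [0, 1]] | x. True}"

definition squares :: "'a::field set" where
  "squares = {y ^ 2 | y. True}"

(* g $ 2 $ 1 is the entry in row 2, column 1. *)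
definition Omega :: "('a::field ^ 2 ^ 2) set" where
  "Omega = {g \<in> carrier SL2. g $ 2 $ 1 \<in> squares}"

definition Omega_c :: "('a::field ^ 2 ^ 2) set" where
  "Omega_c = carrier SL2 - Omega"

definition A_odd :: "('a::field ^ 2 ^ 2) set set" where
  "A_odd = {T #>\<^bsub>SL2\<^esub> g | g. g \<in> Omega} \<union> {g <#\<^bsub>SL2\<^esub> T | g. g \<in> Omega_c}"

definition A'_odd :: "('a::field ^ 2 ^ 2) set set" where
  "A'_odd = {T #>\<^bsub>SL2\<^esub> g | g. g \<in> Omega_c} \<union> {g <#\<^bsub>SL2\<^esub> T | g. g \<in> Omega}"

(* The conjugating matrix is any invertible one, since the matrix f = diag(1, v) of the
   theorem lies outside SL(2,q). *)
definition conj_set :: "'a::field ^ 2 ^ 2 \<Rightarrow> ('a ^ 2 ^ 2) set \<Rightarrow> ('a ^ 2 ^ 2) set" where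
  "conj_set h X = (\<lambda>x. matrix_inv h ** x ** h) ` X"

definition pi_odd :: "('a::field ^ 2 ^ 2) set set set" where
  "pi_odd = {conj_set h ` A_odd | h. h \<in> carrier SL2}"

definition pi'_odd :: "('a::field ^ 2 ^ 2) set set set" where
  "pi'_odd = {conj_set h ` A'_odd | h. h \<in> carrier SL2}"

end

theory Submission
  imports Defs "HOL-Algebra.Group_Action"
begin

text \<open>
  Let \<open>T\<close> be a subgroup of a group \<open>G\<close> and \<open>W\<close> a union of \<open>T\<close>-double cosets that is invariant under
  conjugation by the normaliser \<open>N\<close> of \<open>T\<close>. The cosets \<open>Tg\<close> with \<open>g \<in> W\<close> and \<open>gT\<close> with
  \<open>g \<notin> W\<close> partition \<open>G\<close>; call this partition \<open>A\<close>. A coset \<open>X = k\<inverse>Tyk\<close> of a conjugate of \<open>T\<close>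
  can only lie in \<open>A\<^sup>k\<close>, as a right coset, or in \<open>A\<^sup>y\<^sup>k\<close>, as a left coset. Both
  cases refer to the same element \<open>y\<close>, so exactly one of them occurs, according to whether
  \<open>y \<in> W\<close>. Hence the conjugates of \<open>A\<close>, indexed by the cosets of \<open>N\<close>, partition the set of all such
  cosets. For \<open>SL(2,q)\<close> the subgroup \<open>N\<close> consists of the upper triangular matrices and has index \<open>q + 1\<close>;
  conjugation by \<open>diag(a, 1/a)\<close> changes the lower-left entry by a square factor, so both
  \<open>\<Omega>\<close> and its complement qualify as \<open>W\<close>. Conjugation by \<open>diag(1, v)\<close> divides this entry by \<open>v\<close>
  and so exchanges them, except where the entry is \<open>0\<close>; there \<open>Tg = gT\<close>.
\<close>

subsection \<open>Conjugate subgroups and cosets\<close>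

context group
begin

lemma mult_inv_cancel:
  assumes "x \<in> carrier G" "y \<in> carrier G"
  shows "x \<otimes> (inv x \<otimes> y) = y" "inv x \<otimes> (x \<otimes> y) = y"
  using assms by (simp_all flip: m_assoc)

text \<open>A right action: composition multiplies the conjugating elements from left to right, so a
  factor normalising \<open>T\<close> is absorbed when it stands on the left.\<close>

definition conj_by :: "'a \<Rightarrow> 'a set \<Rightarrow> 'a set" where
  "conj_by h X = (\<lambda>x. inv h \<otimes> x \<otimes> h) ` X"

lemma conj_by_closed: "X \<subseteq> carrier G \<Longrightarrow> h \<in> carrier G \<Longrightarrow> conj_by h X \<subseteq> carrier G"
  by (auto simp: conj_by_def)

lemma conj_by_conj_by:
  assumes "X \<subseteq> carrier G" "g \<in> carrier G" "h \<in> carrier G"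
  shows "conj_by h (conj_by g X) = conj_by (g \<otimes> h) X"
  unfolding conj_by_def image_image using assms
  by (intro image_cong) (auto simp: inv_mult_group m_assoc subset_iff)

lemma conj_by_one: "X \<subseteq> carrier G \<Longrightarrow> conj_by \<one> X = X"
  by (force simp: conj_by_def subset_iff image_iff)

lemma conj_by_inv_cancel:
  assumes "X \<subseteq> carrier G" "h \<in> carrier G"
  shows "conj_by (inv h) (conj_by h X) = X" "conj_by h (conj_by (inv h) X) = X"
  using assms by (simp_all add: conj_by_conj_by conj_by_one)

lemma conj_by_inject:
  assumes "X \<subseteq> carrier G" "Y \<subseteq> carrier G" "h \<in> carrier G"
  shows "conj_by h X = conj_by h Y \<longleftrightarrow> X = Y"
  using assms by (metis conj_by_inv_cancel(1))

lemma conj_by_r_coset: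
  assumes "X \<subseteq> carrier G" "y \<in> carrier G" "h \<in> carrier G"
  shows "conj_by h (X #> y) = conj_by h X #> (inv h \<otimes> y \<otimes> h)"
proof -
  have "inv h \<otimes> (x \<otimes> y) \<otimes> h = inv h \<otimes> x \<otimes> h \<otimes> (inv h \<otimes> y \<otimes> h)" if "x \<in> X" for x
    using assms that by (simp add: m_assoc mult_inv_cancel subset_iff)
  then show ?thesis
    by (auto simp: conj_by_def r_coset_def image_iff)
qed

text \<open>Since \<open>yX = y(Xy)y^-1\<close>, every left coset is a conjugate of a right coset.
  This allows left and right cosets to be treated in one form.\<close>

lemma l_coset_eq_conj_by:
  assumes "X \<subseteq> carrier G" "y \<in> carrier G"
  shows "y <# X = conj_by (inv y) (X #> y)"
proof -
  have "inv (inv y) \<otimes> (x \<otimes> y) \<otimes> inv y = y \<otimes> x" if "x \<in> X" for x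
    using assms that by (simp add: m_assoc subset_iff)
  then show ?thesis
    by (auto simp: conj_by_def r_coset_def l_coset_def image_iff)
qed

lemma conj_by_l_coset:
  assumes "X \<subseteq> carrier G" "y \<in> carrier G" "h \<in> carrier G"
  shows "conj_by h (y <# X) = (inv h \<otimes> y \<otimes> h) <# conj_by h X"
proof -
  have "inv h \<otimes> (y \<otimes> x) \<otimes> h = inv h \<otimes> y \<otimes> h \<otimes> (inv h \<otimes> x \<otimes> h)" if "x \<in> X" for x
    using assms that by (simp add: m_assoc mult_inv_cancel subset_iff)
  then show ?thesis
    by (auto simp: conj_by_def l_coset_def image_iff)
qed

lemma card_conj_by:
  assumes "X \<subseteq> carrier G" "h \<in> carrier G"
  shows "card (conj_by h X) = card X"
  unfolding conj_by_def using assms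
  by (intro card_image inj_onI) (simp add: subset_iff m_assoc)

lemma subgroup_conj_by:
  assumes "subgroup H G" "h \<in> carrier G"
  shows "subgroup (conj_by h H) G"
proof -
  interpret H: subgroup H G by fact
  show ?thesis
  proof
    show "conj_by h H \<subseteq> carrier G"
      using assms by (simp add: conj_by_closed H.subset)
    show "\<one> \<in> conj_by h H"
      using assms by (auto simp: conj_by_def image_iff intro!: bexI[of _ \<one>])
  next
    fix x assume "x \<in> conj_by h H"
    then obtain a where a: "a \<in> H" "x = inv h \<otimes> a \<otimes> h" by (auto simp: conj_by_def)
    show "inv x \<in> conj_by h H"
      unfolding conj_by_def using a assms
      by (auto simp: inv_mult_group m_assoc intro!: image_eqI[of _ _ "inv a"])
  next
    fix x y assume "x \<in> conj_by h H" "y \<in> conj_by h H"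
    then obtain a b where a: "a \<in> H" "x = inv h \<otimes> a \<otimes> h" "b \<in> H" "y = inv h \<otimes> b \<otimes> h"
      by (auto simp: conj_by_def)
    have "x \<otimes> y = inv h \<otimes> (a \<otimes> b) \<otimes> h"
      using a assms by (simp add: m_assoc mult_inv_cancel)
    then show "x \<otimes> y \<in> conj_by h H"
      unfolding conj_by_def using a by auto
  qed
qed

text \<open>Moving \<open>a\<close> across exhibits \<open>H\<close> as a right coset of
  \<open>K\<close>; it contains the identity, so it is \<open>K\<close> itself.\<close>

lemma r_coset_eq_imp_subgroup_eq:
  assumes "subgroup H G" "subgroup K G" "a \<in> carrier G" "b \<in> carrier G" "H #> a = K #> b"
  shows "H = K"
proof -
  have sub: "H \<subseteq> carrier G" "K \<subseteq> carrier G"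
    using assms by (auto dest: subgroup.subset)
  have eq: "H = K #> (b \<otimes> inv a)"
    using assms sub by (metis coset_mult_assoc coset_mult_inv1 coset_mult_one inv_closed r_inv)
  then have "\<one> \<in> K #> (b \<otimes> inv a)"
    using assms(1) subgroup.one_closed by blast
  then have "K #> (b \<otimes> inv a) = K #> \<one>"
    using assms by (intro repr_independence) auto
  with eq sub show ?thesis by simp
qed

end

section \<open>Conjugacy of Sylow subgroups\<close>

text \<open>\<open>P\<close> acts on the right cosets of \<open>Q\<close> by right multiplication.
  Orbit sizes are powers of \<open>p\<close> and the number of cosets is prime to \<open>p\<close>,
  so some coset \<open>Qg\<close> is fixed; \<open>Qgx = Qg\<close> for all \<open>x\<close> in
  \<open>P\<close> says that \<open>P\<close> lies in \<open>g^-1 Q g\<close>.\<close>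

lemma (in group) p_subgroup_le_conj_by:
  assumes fin: "finite (carrier G)" and p: "prime p"
    and P: "subgroup P G" "card P = p ^ a" and Q: "subgroup Q G" 
    and index: "\<not> p dvd card (rcosets Q)"
  shows "\<exists>g\<in>carrier G. P \<subseteq> conj_by g Q"
proof -
  interpret P: subgroup P G by fact
  interpret Q: subgroup Q G by fact
  let ?P = "G\<lparr>carrier := P\<rparr>"
  let ?E = "rcosets Q"
  \<comment> \<open>The inverse turns right multiplication into a left action, as a homomorphism
    into \<open>BijGroup\<close> requires; the restriction to \<open>?E\<close> makes each map
    extensional.\<close>
  define \<phi> where "\<phi> = (\<lambda>g. \<lambda>X\<in>?E. X #> inv g)"
  interpret GP: group ?P by (rule P.subgroup_is_group) (rule is_group)
  have closed: "X #> g \<in> ?E" if "X \<in> ?E" "g \<in> carrier G" for X g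
    using that Q.subset by (auto simp: RCOSETS_def coset_mult_assoc)
  have sub: "X \<subseteq> carrier G" if "X \<in> ?E" for X
    using that Q.rcosets_carrier[OF is_group] by blast
  interpret BE: group "BijGroup ?E" by (rule group_BijGroup)
  have "group_action ?P ?E \<phi>"
  proof (unfold_locales)
    show "\<phi> \<in> hom ?P (BijGroup ?E)"
    proof (rule homI)
      fix g assume g: "g \<in> carrier ?P"
      show "\<phi> g \<in> carrier (BijGroup ?E)"
        unfolding BijGroup_def Bij_def \<phi>_def using g
        by (auto intro!: bij_betw_byWitness[of _ "\<lambda>X. X #> g"] closed simp: coset_mult_assoc sub coset_mult_one)
    next
      fix g h assume g: "g \<in> carrier ?P" "h \<in> carrier ?P"
      have "\<phi> (g \<otimes> h) = compose ?E (\<phi> g) (\<phi> h)"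
        unfolding \<phi>_def compose_def using g
        by (auto intro!: restrict_ext simp: closed sub coset_mult_assoc inv_mult_group)
      moreover have "\<phi> x \<in> Bij ?E" if "x \<in> P" for x
        unfolding Bij_def \<phi>_def using that
        by (auto intro!: bij_betw_byWitness[of _ "\<lambda>X. X #> x"] closed simp: coset_mult_assoc sub coset_mult_one)
      ultimately show "\<phi> (g \<otimes>\<^bsub>?P\<^esub> h) = \<phi> g \<otimes>\<^bsub>BijGroup ?E\<^esub> \<phi> h"
        using g by (simp add: BijGroup_def)
    qed
  qed
  then interpret act: group_action ?P ?E \<phi> .
  have finE: "finite ?E"
    using fin by (simp add: RCOSETS_def)
  have "\<exists>X\<in>?E. card (orbit ?P \<phi> X) = 1"
  proof (rule ccontr)
    assume no: "\<not> ?thesis"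
    have "p dvd card orb" if orb: "orb \<in> orbits ?P ?E \<phi>" for orb
    proof -
      obtain X where X: "X \<in> ?E" "orb = orbit ?P \<phi> X"
        using orb by (auto simp: orbits_def)
      have "card orb dvd p ^ a"
        using act.orbit_stabilizer_theorem[OF X(1)] P(2) X(2)
        by (metis dvd_triv_left order_def partial_object.select_convs(1) partial_object.surjective partial_object.update_convs(1))
      then obtain i where "card orb = p ^ i"
        using p divides_primepow_nat by blast
      moreover have "card orb \<noteq> 1" using no X by auto
      ultimately show ?thesis by (cases i) auto
    qed
    then have "p dvd (\<Sum>orb\<in>orbits ?P ?E \<phi>. card orb)"
      by (intro dvd_sum)
    then show False
      using act.disjoint_sum[OF finE, of "\<lambda>_. 1::nat"] index by simp
  qed
  then obtain X where X: "X \<in> ?E" "card (orbit ?P \<phi> X) = 1" by blast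
  then obtain g where g: "g \<in> carrier G" "X = Q #> g" by (auto simp: RCOSETS_def)
  have "X \<in> orbit ?P \<phi> X" using act.orbit_refl X(1) by simp
  with X(2) have fix_X: "orbit ?P \<phi> X = {X}" by (metis card_1_singletonE singletonD)
  have "P \<subseteq> conj_by g Q"
  proof
    fix x assume x: "x \<in> P"
    \<comment> \<open>Because \<open>\<phi>\<close> inverts its argument, \<open>inv x\<close> acts
      as right multiplication by \<open>x\<close>.\<close>
    have "\<phi> (inv x) X \<in> orbit ?P \<phi> X"
      unfolding orbit_def using x by auto
    with fix_X have "\<phi> (inv x) X = X" by blast
    with X x have "X #> x = X" by (simp add: \<phi>_def)
    with g x have "Q #> (g \<otimes> x) = Q #> g" by (simp add: coset_mult_assoc Q.subset)
    then have "g \<otimes> x \<in> Q #> g"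
      using g x Q by (metis P.mem_carrier m_closed rcos_self)
    then obtain t where t: "t \<in> Q" "g \<otimes> x = t \<otimes> g" by (auto simp: r_coset_def)
    have "x = inv g \<otimes> (g \<otimes> x)"
      using g x by (simp flip: m_assoc)
    also have "\<dots> = inv g \<otimes> t \<otimes> g"
      using g x t by (simp add: m_assoc)
    finally have "x = inv g \<otimes> t \<otimes> g" .
    with t show "x \<in> conj_by g Q" by (auto simp: conj_by_def)
  qed
  with g show ?thesis by blast
qed

text \<open>The order of \<open>T\<close> is the full power of \<open>p\<close>, so its index is
  prime to \<open>p\<close> and every Sylow subgroup lies in a conjugate of \<open>T\<close>; equal
  cardinalities make the inclusion an equality.\<close>

lemma (in group) sylow_subgroups_eq_conj_by:
  fixes T :: "'a set"
  assumes fin: "finite (carrier G)" and p: "prime p" and T: "T \<in> sylow_subgroups p G"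
  shows "sylow_subgroups p G = {conj_by g T | g. g \<in> carrier G}"
proof (intro equalityI subsetI)
  fix P assume P: "P \<in> sylow_subgroups p G"
  have "order G \<noteq> 0" using fin order_gt_0_iff_finite by simp
  have T': "subgroup T G" "card T = p ^ multiplicity p (order G)"
    using T by (auto simp: sylow_subgroups_def)
  have "\<not> p dvd card (rcosets T)"
  proof
    assume "p dvd card (rcosets T)"
    then have "p ^ Suc (multiplicity p (order G)) dvd order G"
      using lagrange[OF T'(1)] T'(2) by (metis dvd_refl mult_dvd_mono power_Suc)
    then show False
      using power_dvd_iff_le_multiplicity \<open>order G \<noteq> 0\<close> p
      by (metis Suc_n_not_le_n not_prime_unit)
  qed
  then obtain g where g: "g \<in> carrier G" "P \<subseteq> conj_by g T"
    using p_subgroup_le_conj_by[OF fin p, of P _ T] P T' by (auto simp: sylow_subgroups_def)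
  have "conj_by g T \<subseteq> carrier G"
    using g T' by (simp add: conj_by_closed subgroup.subset)
  moreover have "card P = card (conj_by g T)"
    using g P T' by (simp add: card_conj_by subgroup.subset sylow_subgroups_def)
  ultimately have "P = conj_by g T"
    using g(2) fin by (intro card_subset_eq) (auto intro: finite_subset)
  with g show "P \<in> {conj_by g T | g. g \<in> carrier G}" by blast
qed (use T in \<open>auto simp: sylow_subgroups_def subgroup_conj_by card_conj_by subgroup.subset\<close>)

text \<open>By \<open>(k^-1 T k) g = k^-1 (T k g k^-1) k\<close>, cosets of all Sylow subgroups
  reduce to conjugates of cosets of the single subgroup \<open>T\<close>.\<close>

lemma (in group) sylow_cosets_eq_conj_by:
  fixes T :: "'a set"
  assumes "finite (carrier G)" "prime p" "T \<in> sylow_subgroups p G"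
  shows "sylow_cosets p G = {conj_by k (T #> y) | k y. k \<in> carrier G \<and> y \<in> carrier G}"
proof -
  have T: "T \<subseteq> carrier G"
    using assms(3) by (auto simp: sylow_subgroups_def subgroup_def)
  have eq: "conj_by k (T #> (k \<otimes> g \<otimes> inv k)) = conj_by k T #> g"
    if "k \<in> carrier G" "g \<in> carrier G" for k g
    using that T by (simp add: conj_by_r_coset m_assoc mult_inv_cancel)
  have "sylow_cosets p G = {conj_by k T #> g | k g. k \<in> carrier G \<and> g \<in> carrier G}"
    unfolding sylow_cosets_def sylow_subgroups_eq_conj_by[OF assms] by blast
  also have "\<dots> = {conj_by k (T #> y) | k y. k \<in> carrier G \<and> y \<in> carrier G}"
  proof (intro equalityI subsetI)
    fix X assume "X \<in> {conj_by k T #> g | k g. k \<in> carrier G \<and> g \<in> carrier G}"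
    then obtain k g where kg: "X = conj_by k T #> g" "k \<in> carrier G" "g \<in> carrier G" by blast
    then have "X = conj_by k (T #> (k \<otimes> g \<otimes> inv k))" "k \<otimes> g \<otimes> inv k \<in> carrier G"
      by (simp_all add: eq)
    with kg(2) show "X \<in> {conj_by k (T #> y) | k y. k \<in> carrier G \<and> y \<in> carrier G}" by blast
  next
    fix X assume "X \<in> {conj_by k (T #> y) | k y. k \<in> carrier G \<and> y \<in> carrier G}"
    then obtain k y where ky: "X = conj_by k (T #> y)" "k \<in> carrier G" "y \<in> carrier G" by blast
    then have "X = conj_by k T #> (inv k \<otimes> y \<otimes> k)" "inv k \<otimes> y \<otimes> k \<in> carrier G"
      using T by (simp_all add: conj_by_r_coset)
    with ky(2) show "X \<in> {conj_by k T #> g | k g. k \<in> carrier G \<and> g \<in> carrier G}" by blast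
  qed
  finally show ?thesis .
qed

text \<open>Both maps have the same fibres, so sending \<open>f x\<close> to \<open>g x\<close> is a
  well-defined bijection between the images. It serves to count parallel classes by cosets of the
  normaliser.\<close>

lemma card_image_cong_iff:
  assumes "\<And>x y. x \<in> A \<Longrightarrow> y \<in> A \<Longrightarrow> f x = f y \<longleftrightarrow> g x = g y"
  shows "card (f ` A) = card (g ` A)"
proof -
  have g: "g (inv_into A f (f x)) = g x" if "x \<in> A" for x
    using assms[of "inv_into A f (f x)" x] that by (simp add: inv_into_into f_inv_into_f)
  have "inj_on (\<lambda>u. g (inv_into A f u)) (f ` A)"
    by (rule inj_onI) (use g assms in force)
  moreover have "(\<lambda>u. g (inv_into A f u)) ` f ` A = g ` A"
    unfolding image_image by (intro image_cong refl g)
  ultimately show ?thesis by (metis card_image)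
qed

subsection \<open>Parallel classes from a conjugation-invariant set\<close>

text \<open>The closure conditions on \<open>W\<close> are implications; since \<open>T\<close> and
  its normaliser contain inverses, they become equivalences below and so pass to the complement of
  \<open>W\<close>.\<close>

locale twisted_cosets = group +
  fixes T W :: "'a set"
  assumes T: "subgroup T G" and W: "W \<subseteq> carrier G"
    and mult_W_left: "t \<in> T \<Longrightarrow> g \<in> W \<Longrightarrow> t \<otimes> g \<in> W"
    and mult_W_right: "t \<in> T \<Longrightarrow> g \<in> W \<Longrightarrow> g \<otimes> t \<in> W"
    and conj_W: "n \<in> carrier G \<Longrightarrow> conj_by n T = T \<Longrightarrow> g \<in> W \<Longrightarrow> inv n \<otimes> g \<otimes> n \<in> W"
begin

sublocale T: subgroup T G by (fact T)

definition normalizer_T :: "'a set" where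
  "normalizer_T = {n \<in> carrier G. conj_by n T = T}"

definition base_class :: "'a set set" where
  "base_class = {T #> g | g. g \<in> W} \<union> {g <# T | g. g \<in> carrier G - W}"

definition parallel_classes :: "'a set set set" where
  "parallel_classes = {conj_by h ` base_class | h. h \<in> carrier G}"

text \<open>When \<open>T\<close> is a Sylow subgroup of a finite group, these are all cosets of
  Sylow subgroups, by \<open>sylow_cosets_eq_conj_by\<close>.\<close>

definition coset_set :: "'a set set" where
  "coset_set = {conj_by k (T #> y) | k y. k \<in> carrier G \<and> y \<in> carrier G}"

lemma normalizer_T_carrier: "n \<in> normalizer_T \<Longrightarrow> n \<in> carrier G"
  by (simp add: normalizer_T_def)

lemma subgroup_normalizer_T: "subgroup normalizer_T G"
proof
  show "normalizer_T \<subseteq> carrier G" by (auto simp: normalizer_T_def)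
  show "\<one> \<in> normalizer_T" by (simp add: normalizer_T_def conj_by_one T.subset)
  show "x \<otimes> y \<in> normalizer_T" if "x \<in> normalizer_T" "y \<in> normalizer_T" for x y
    using that by (simp add: normalizer_T_def flip: conj_by_conj_by[OF T.subset])
  show "inv x \<in> normalizer_T" if "x \<in> normalizer_T" for x
  proof -
    have "conj_by (inv x) T = conj_by (inv x) (conj_by x T)"
      using that by (simp add: normalizer_T_def)
    also have "\<dots> = T"
      using that by (intro conj_by_inv_cancel T.subset) (simp add: normalizer_T_def)
    finally show ?thesis using that by (simp add: normalizer_T_def)
  qed
qed

lemmas normalizer_T_m_inv_closed = subgroup.m_inv_closed[OF subgroup_normalizer_T]
  and normalizer_T_m_closed = subgroup.m_closed[OF subgroup_normalizer_T]

text \<open>Closure of \<open>T\<close> gives one inclusion for every element of \<open>T\<close>;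
  applying it to \<open>inv t\<close> and conjugating back by \<open>t\<close> gives the
  other.\<close>

lemma T_subset_normalizer_T: "T \<subseteq> normalizer_T"
proof
  fix t assume t: "t \<in> T"
  have sub: "conj_by s T \<subseteq> T" if "s \<in> T" for s
    unfolding conj_by_def using that by (intro image_subsetI T.m_closed T.m_inv_closed)
  have "conj_by t (conj_by (inv t) T) \<subseteq> conj_by t T"
    unfolding conj_by_def[of t] by (rule image_mono[OF sub[OF T.m_inv_closed[OF t]]])
  then have "T \<subseteq> conj_by t T"
    unfolding conj_by_inv_cancel(2)[OF T.subset T.mem_carrier[OF t]] .
  with sub[OF t] have "conj_by t T = T" by (rule subset_antisym)
  with t show "t \<in> normalizer_T"
    by (simp add: normalizer_T_def)
qed

lemma r_coset_carrier: "y \<in> carrier G \<Longrightarrow> T #> y \<subseteq> carrier G"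
  by (simp add: r_coset_subset_G T.subset)

lemma conj_W_iff:
  assumes "n \<in> normalizer_T" "g \<in> carrier G"
  shows "inv n \<otimes> g \<otimes> n \<in> W \<longleftrightarrow> g \<in> W"
proof
  assume "inv n \<otimes> g \<otimes> n \<in> W"
  then have "inv (inv n) \<otimes> (inv n \<otimes> g \<otimes> n) \<otimes> inv n \<in> W"
    using conj_W[of "inv n"] normalizer_T_m_inv_closed[OF assms(1)] by (simp add: normalizer_T_def)
  moreover have "inv (inv n) \<otimes> (inv n \<otimes> g \<otimes> n) \<otimes> inv n = g"
    using assms normalizer_T_carrier[OF assms(1)] by (simp add: m_assoc mult_inv_cancel)
  ultimately show "g \<in> W" using assms normalizer_T_carrier[OF assms(1)] by simp
qed (use conj_W assms in \<open>auto simp: normalizer_T_def\<close>)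

lemma mult_left_W_iff:
  assumes "t \<in> T" "g \<in> carrier G"
  shows "t \<otimes> g \<in> W \<longleftrightarrow> g \<in> W"
  using assms mult_W_left[of t g] mult_W_left[of "inv t" "t \<otimes> g"]
  by (auto simp flip: m_assoc)

lemma mult_right_W_iff:
  assumes "t \<in> T" "g \<in> carrier G"
  shows "g \<otimes> t \<in> W \<longleftrightarrow> g \<in> W"
  using assms mult_W_right[of t g] mult_W_right[of "inv t" "g \<otimes> t"]
  by (auto simp: m_assoc)

section \<open>The base class as a partition of the group\<close>

lemma base_class_subset: "X \<in> base_class \<Longrightarrow> X \<subseteq> carrier G"
  unfolding base_class_def using W r_coset_carrier l_coset_subset_G[OF T.subset] by blast

text \<open>Since \<open>W\<close> is a union of double cosets of \<open>T\<close>, a block lies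
  wholly inside or wholly outside \<open>W\<close>. Any element therefore reveals whether its block
  is a right or a left coset, and represents it. Disjointness follows at once.\<close>

lemma base_class_memD:
  assumes "X \<in> base_class" "x \<in> X"
  shows "X = (if x \<in> W then T #> x else x <# T)"
proof -
  consider g where "g \<in> W" "X = T #> g" | g where "g \<in> carrier G - W" "X = g <# T"
    using assms(1) by (auto simp: base_class_def)
  then show ?thesis
  proof cases
    case 1
    then have "x \<in> W" using assms(2) mult_W_left by (auto simp: r_coset_def)
    moreover have "T #> g = T #> x"
      using 1 assms(2) W T by (intro repr_independence) auto
    ultimately show ?thesis using 1 by simp
  next
    case 2
    then have "x \<notin> W" using assms(2) mult_right_W_iff by (auto simp: l_coset_def)
    moreover have "g <# T = x <# T"
      using 2 assms(2) W T by (intro l_repr_independence) auto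
    ultimately show ?thesis using 2 by simp
  qed
qed

lemma disjoint_base_class: "pairwise disjnt base_class"
proof (rule pairwiseI, rule ccontr)
  fix X Y assume XY: "X \<in> base_class" "Y \<in> base_class" "X \<noteq> Y" "\<not> disjnt X Y"
  then obtain x where "x \<in> X" "x \<in> Y" by (auto simp: disjnt_iff)
  with XY show False using base_class_memD[of X x] base_class_memD[of Y x] by simp
qed

lemma Union_base_class: "\<Union>base_class = carrier G"
proof
  show "carrier G \<subseteq> \<Union>base_class"
  proof
    fix x assume x: "x \<in> carrier G"
    have "x \<in> T #> x" "x \<in> x <# T"
      using x T rcos_self by (auto simp: l_coset_def intro!: bexI[of _ \<one>])
    with x show "x \<in> \<Union>base_class" unfolding base_class_def by blast
  qed
qed (use base_class_subset in blast)

lemma card_base_class: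
  assumes "finite (carrier G)"
  shows "card T * card base_class = order G"
proof -
  have fin: "finite base_class"
    using assms base_class_subset by (intro finite_subset[of base_class "Pow (carrier G)"]) auto
  have "card X = card T" if X: "X \<in> base_class" for X
  proof -
    consider g where "g \<in> carrier G" "X = T #> g" | g where "g \<in> carrier G" "X = g <# T"
      using X W by (auto simp: base_class_def)
    then show ?thesis
    proof cases
      case 1
      then show ?thesis
        using card_rcosets_equal[of X T] T.subset rcosetsI by metis
    next
      case 2
      have "inj_on (\<lambda>t. g \<otimes> t) T" using 2 by (auto intro!: inj_onI)
      moreover have "X = (\<lambda>t. g \<otimes> t) ` T" using 2 by (auto simp: l_coset_def)
      ultimately show ?thesis by (simp add: card_image)
    qed
  qed
  then show ?thesis
    unfolding order_def Union_base_class[symmetric]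
    using fin assms disjoint_base_class Union_base_class
    by (intro card_partition) (auto simp: pairwise_def disjnt_def)
qed

text \<open>Conjugation by \<open>n\<close> fixes \<open>T\<close> and preserves both
  \<open>W\<close> and its complement, so right cosets go to right cosets and left ones to left
  ones.\<close>

lemma conj_by_base_class_subset:
  assumes "n \<in> normalizer_T"
  shows "conj_by n ` base_class \<subseteq> base_class"
proof safe
  fix X assume "X \<in> base_class"
  then consider g where "g \<in> W" "X = T #> g" | g where "g \<in> carrier G - W" "X = g <# T"
    by (auto simp: base_class_def)
  then show "conj_by n X \<in> base_class"
  proof cases
    case 1
    then have "conj_by n X = T #> (inv n \<otimes> g \<otimes> n)" "inv n \<otimes> g \<otimes> n \<in> W"
      using assms W conj_W_iff[OF assms, of g] by (auto simp: conj_by_r_coset T.subset normalizer_T_def)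
    then show ?thesis by (auto simp: base_class_def)
  next
    case 2
    then have "conj_by n X = (inv n \<otimes> g \<otimes> n) <# T" "inv n \<otimes> g \<otimes> n \<in> carrier G - W"
      using assms W conj_W_iff[OF assms, of g] by (auto simp: conj_by_l_coset T.subset normalizer_T_def)
    then show ?thesis by (auto simp: base_class_def)
  qed
qed

lemma conj_by_image_mult:
  assumes "n \<in> carrier G" "h \<in> carrier G"
  shows "conj_by h ` conj_by n ` base_class = conj_by (n \<otimes> h) ` base_class"
  unfolding image_image using assms by (intro image_cong) (auto simp: conj_by_conj_by base_class_subset)

lemma conj_by_base_class:
  assumes "n \<in> normalizer_T"
  shows "conj_by n ` base_class = base_class"
proof
  have "base_class = conj_by n ` conj_by (inv n) ` base_class"
    using assms by (simp add: conj_by_image_mult normalizer_T_carrier conj_by_one base_class_subset)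
  also have "\<dots> \<subseteq> conj_by n ` base_class"
    using conj_by_base_class_subset[OF normalizer_T_m_inv_closed[OF assms]] by (rule image_mono)
  finally show "base_class \<subseteq> conj_by n ` base_class" .
qed (rule conj_by_base_class_subset[OF assms])

text \<open>The factor \<open>n\<close> acts first and fixes the base class, so a class depends only
  on the right coset of the normaliser containing \<open>h\<close>.\<close>

lemma conj_by_norm_mult_base_class:
  assumes "n \<in> normalizer_T" "h \<in> carrier G"
  shows "conj_by (n \<otimes> h) ` base_class = conj_by h ` base_class"
  using assms conj_by_image_mult[of n h] by (simp add: conj_by_base_class normalizer_T_carrier)

section \<open>The class containing a given coset\<close>

text \<open>Equal cosets belong to equal subgroups, so \<open>n = k h^-1\<close> normalises
  \<open>T\<close>. Cancelling the conjugation by \<open>h\<close> leaves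
  \<open>Tz = T(n^-1 y n)\<close>, which yields \<open>t\<close>.\<close>

lemma conj_by_r_coset_eqD:
  assumes "k \<in> carrier G" "h \<in> carrier G" "y \<in> carrier G" "z \<in> carrier G"
    and eq: "conj_by k (T #> y) = conj_by h (T #> z)"
  obtains n t where "n \<in> normalizer_T" "t \<in> T" "k = n \<otimes> h" "z = t \<otimes> (inv n \<otimes> y \<otimes> n)"
proof -
  let ?n = "k \<otimes> inv h"
  have rc: "conj_by k T #> (inv k \<otimes> y \<otimes> k) = conj_by h T #> (inv h \<otimes> z \<otimes> h)"
    using eq assms(1-4) by (simp add: conj_by_r_coset T.subset)
  then have kT: "conj_by k T = conj_by h T"
    using assms(1-4) T by (intro r_coset_eq_imp_subgroup_eq[OF _ _ _ _ rc] subgroup_conj_by m_closed inv_closed)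
  have "conj_by ?n T = conj_by (inv h) (conj_by k T)"
    using assms(1-4) by (simp add: conj_by_conj_by T.subset)
  also have "\<dots> = T"
    unfolding kT using assms(1-4) by (simp add: conj_by_inv_cancel T.subset)
  finally have n: "?n \<in> normalizer_T" using assms(1-4) by (simp add: normalizer_T_def)
  have k: "k = ?n \<otimes> h" using assms(1-4) by (simp add: m_assoc)
  let ?y = "inv ?n \<otimes> y \<otimes> ?n"
  have "conj_by h (conj_by ?n (T #> y)) = conj_by k (T #> y)"
    using assms(1-4) by (simp add: conj_by_conj_by r_coset_carrier m_assoc)
  then have "conj_by h (T #> z) = conj_by h (conj_by ?n (T #> y))"
    using eq by (rule trans[THEN sym])
  then have "T #> z = conj_by ?n (T #> y)"
    using assms(1-4) by (simp add: conj_by_inject r_coset_carrier conj_by_closed)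
  also have "\<dots> = T #> ?y"
    using assms(1-4) n by (simp add: conj_by_r_coset T.subset normalizer_T_def)
  finally have "z \<in> T #> ?y" using rcos_self[OF assms(4) T] by simp
  then obtain t where t: "t \<in> T" "z = t \<otimes> ?y" by (auto simp: r_coset_def)
  show thesis by (rule that[OF n t(1) k t(2)])
qed

text \<open>The relation \<open>z = t n^-1 y n\<close> puts \<open>z\<close> and \<open>y\<close> on
  the same side of \<open>W\<close>. So \<open>y\<close> alone decides whether the coset occurs as a
  right or as a left coset, and this fixes \<open>h\<close> up to a left factor from the
  normaliser.\<close>

lemma coset_class_unique:
  assumes "k \<in> carrier G" "y \<in> carrier G" "h \<in> carrier G"
    and mem: "conj_by k (T #> y) \<in> conj_by h ` base_class"
  obtains n where "n \<in> normalizer_T" "(if y \<in> W then k else y \<otimes> k) = n \<otimes> h"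
proof -
  from mem consider z where "z \<in> W" "conj_by k (T #> y) = conj_by h (T #> z)"
    | z where "z \<in> carrier G - W" "conj_by k (T #> y) = conj_by h (z <# T)"
    by (auto simp: base_class_def)
  then show ?thesis
  proof cases
    case 1
    with W have z: "z \<in> carrier G" by blast
    from conj_by_r_coset_eqD[OF assms(1,3,2) z 1(2)] obtain n t where
      nt: "n \<in> normalizer_T" "t \<in> T" "k = n \<otimes> h" "z = t \<otimes> (inv n \<otimes> y \<otimes> n)" .
    then have "y \<in> W"
      using 1(1) assms(2) by (simp add: mult_left_W_iff conj_W_iff normalizer_T_carrier)
    with nt that show ?thesis by auto
  next
    case 2
    then have z: "z \<in> carrier G" by blast
    \<comment> \<open>Rewriting \<open>zT\<close> as a conjugate of \<open>Tz\<close> makes the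
      comparison of right cosets applicable, with \<open>z^-1 h\<close> in place of
      \<open>h\<close>.\<close>
    have "conj_by k (T #> y) = conj_by (inv z \<otimes> h) (T #> z)"
      using 2 z assms by (simp add: l_coset_eq_conj_by T.subset conj_by_conj_by r_coset_carrier)
    from conj_by_r_coset_eqD[OF assms(1) _ assms(2) z this] z assms obtain n t where
      nt: "n \<in> normalizer_T" "t \<in> T" "k = n \<otimes> (inv z \<otimes> h)" "z = t \<otimes> (inv n \<otimes> y \<otimes> n)" by auto
    note n = normalizer_T_carrier[OF nt(1)]
    from nt have "y \<notin> W"
      using 2(1) assms(2) n by (simp add: mult_left_W_iff conj_W_iff)
    \<comment> \<open>Together with \<open>k = n z^-1 h\<close> this gives
      \<open>y k = n t^-1 h\<close>, where \<open>n t^-1\<close> normalises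
      \<open>T\<close>.\<close>
    moreover have "y \<otimes> n = n \<otimes> (inv t \<otimes> z)"
      using nt(2,4) n assms(2) by (simp add: m_assoc mult_inv_cancel)
    then have "y \<otimes> k = n \<otimes> inv t \<otimes> h"
      using nt(2,3) n assms z by (simp add: flip: m_assoc) (simp add: m_assoc)
    moreover have "n \<otimes> inv t \<in> normalizer_T"
      using nt T_subset_normalizer_T by (intro normalizer_T_m_closed) auto
    ultimately show ?thesis using that by auto
  qed
qed

text \<open>The existence half: for \<open>y\<close> outside \<open>W\<close>,
  \<open>k^-1 T y k = (yk)^-1 (yT) (yk)\<close> is a conjugate of a left coset in the base
  class.\<close>

lemma coset_mem_class:
  assumes "k \<in> carrier G" "y \<in> carrier G"
  shows "conj_by k (T #> y) \<in> conj_by (if y \<in> W then k else y \<otimes> k) ` base_class"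
proof (cases "y \<in> W")
  case True
  then show ?thesis by (auto simp: base_class_def)
next
  case False
  then have "conj_by k (T #> y) = conj_by (y \<otimes> k) (y <# T)"
    using assms by (simp add: l_coset_eq_conj_by T.subset conj_by_conj_by r_coset_carrier flip: m_assoc)
  with False assms show ?thesis by (auto simp: base_class_def)
qed

lemma Union_classes: "\<Union>parallel_classes = coset_set"
proof (intro equalityI subsetI)
  fix X assume "X \<in> \<Union>parallel_classes"
  then obtain h Y where h: "h \<in> carrier G" "Y \<in> base_class" "X = conj_by h Y"
    by (auto simp: parallel_classes_def)
  then consider g where "g \<in> carrier G" "Y = T #> g" | g where "g \<in> carrier G" "Y = g <# T"
    using W by (auto simp: base_class_def)
  then show "X \<in> coset_set"
  proof cases
    case 1
    with h show ?thesis by (auto simp: coset_set_def)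
  next
    case 2
    then have "X = conj_by (inv g \<otimes> h) (T #> g)"
      using h by (simp add: l_coset_eq_conj_by T.subset conj_by_conj_by r_coset_carrier)
    with h 2 show ?thesis unfolding coset_set_def by blast
  qed
next
  fix X assume "X \<in> coset_set"
  then obtain k y where "k \<in> carrier G" "y \<in> carrier G" "X = conj_by k (T #> y)"
    by (auto simp: coset_set_def)
  then show "X \<in> \<Union>parallel_classes"
    using coset_mem_class[of k y] unfolding parallel_classes_def by (auto split: if_splits)
qed

lemma partition_on_classes: "partition_on coset_set parallel_classes"
proof (rule partition_onI[OF Union_classes])
  fix B C assume B: "B \<in> parallel_classes" "C \<in> parallel_classes" "B \<noteq> C"
  show "disjnt B C"
  proof (rule ccontr)
    assume "\<not> disjnt B C"
    then obtain X where X: "X \<in> B" "X \<in> C" by (auto simp: disjnt_iff)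
    with B Union_classes have "X \<in> coset_set" by blast
    then obtain k y where ky: "k \<in> carrier G" "y \<in> carrier G" "X = conj_by k (T #> y)"
      by (auto simp: coset_set_def)
    \<comment> \<open>Every class containing \<open>X\<close> equals one computed from
      \<open>k\<close> and \<open>y\<close> alone, so \<open>B\<close> and \<open>C\<close>
      coincide.\<close>
    have "D = conj_by (if y \<in> W then k else y \<otimes> k) ` base_class" if "D \<in> parallel_classes" "X \<in> D" for D
    proof -
      from that obtain h where h: "h \<in> carrier G" "D = conj_by h ` base_class"
        by (auto simp: parallel_classes_def)
      from that h ky have "conj_by k (T #> y) \<in> conj_by h ` base_class" by simp
      from coset_class_unique[OF ky(1,2) h(1) this] obtain n where
        n: "n \<in> normalizer_T" "(if y \<in> W then k else y \<otimes> k) = n \<otimes> h" .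
      show ?thesis
        unfolding n(2) h(2) by (rule conj_by_norm_mult_base_class[OF n(1) h(1), symmetric])
    qed
    with B X show False by metis
  qed
next
  have "base_class \<noteq> {}" using Union_base_class by auto
  then show "{} \<notin> parallel_classes" by (auto simp: parallel_classes_def)
qed

section \<open>Counting the classes\<close>

lemma conj_by_base_class_eq_iff:
  assumes "h \<in> carrier G" "k \<in> carrier G"
  shows "conj_by k ` base_class = conj_by h ` base_class \<longleftrightarrow> normalizer_T #> k = normalizer_T #> h"
proof
  assume eq: "conj_by k ` base_class = conj_by h ` base_class"
  \<comment> \<open>The coset \<open>k^-1 T k\<close> serves as a probe: for
    \<open>y = \<one>\<close> both \<open>k\<close> and \<open>y k\<close> are \<open>k\<close>,
    whether or not \<open>\<one>\<close> lies in \<open>W\<close>.\<close>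
  have "conj_by k (T #> \<one>) \<in> conj_by h ` base_class"
    using coset_mem_class[of k \<one>] assms eq by (simp split: if_splits)
  from coset_class_unique[OF assms(2) _ assms(1) this] obtain n where
    "n \<in> normalizer_T" "(if \<one> \<in> W then k else \<one> \<otimes> k) = n \<otimes> h" by auto
  then have "k \<in> normalizer_T #> h" using assms by (auto simp: r_coset_def split: if_splits)
  then show "normalizer_T #> k = normalizer_T #> h"
    using assms subgroup_normalizer_T by (metis repr_independence)
next
  assume "normalizer_T #> k = normalizer_T #> h"
  then have "k \<in> normalizer_T #> h" using assms subgroup_normalizer_T by (metis rcos_self)
  then obtain n where "n \<in> normalizer_T" "k = n \<otimes> h" by (auto simp: r_coset_def)
  then show "conj_by k ` base_class = conj_by h ` base_class"
    using assms by (simp add: conj_by_norm_mult_base_class)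
qed

lemma card_classes:
  shows "card parallel_classes * card normalizer_T = order G"
proof -
  let ?class = "\<lambda>h. conj_by h ` base_class" and ?coset = "\<lambda>h. normalizer_T #> h"
  have "card (?class ` carrier G) = card (?coset ` carrier G)"
    by (rule card_image_cong_iff) (rule conj_by_base_class_eq_iff)
  moreover have "?class ` carrier G = parallel_classes"
    unfolding parallel_classes_def by blast
  moreover have "?coset ` carrier G = rcosets normalizer_T"
    unfolding RCOSETS_def by blast
  ultimately show ?thesis
    using lagrange[OF subgroup_normalizer_T] by simp
qed

lemma card_class:
  assumes "B \<in> parallel_classes"
  shows "card B = card base_class"
proof -
  obtain h where "h \<in> carrier G" "B = conj_by h ` base_class"
    using assms by (auto simp: parallel_classes_def)
  then show ?thesis
    by (simp add: card_image inj_on_def conj_by_inject base_class_subset)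
qed

lemma disjoint_class:
  assumes "B \<in> parallel_classes"
  shows "pairwise disjnt B"
proof -
  obtain h where h: "h \<in> carrier G" "B = conj_by h ` base_class"
    using assms by (auto simp: parallel_classes_def)
  have inj: "inj_on (\<lambda>x. inv h \<otimes> x \<otimes> h) (carrier G)"
    using h by (auto intro!: inj_onI simp: m_assoc)
  show ?thesis
    unfolding h
  proof (rule pairwise_imageI)
    fix X Y assume XY: "X \<in> base_class" "Y \<in> base_class" "X \<noteq> Y"
    then have "X \<inter> Y = {}" "X \<subseteq> carrier G" "Y \<subseteq> carrier G"
      using disjoint_base_class base_class_subset by (auto simp: pairwise_def disjnt_def)
    then show "disjnt (conj_by h X) (conj_by h Y)"
      unfolding conj_by_def disjnt_def using inj_on_image_Int[OF inj, of X Y] by simp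
  qed
qed

text \<open>Passing to the complement exchanges the roles of left and right cosets; for
  \<open>Omega\<close> this yields the second parallelism.\<close>

lemma twisted_cosets_complement: "twisted_cosets G T (carrier G - W)"
proof unfold_locales
  show "inv n \<otimes> g \<otimes> n \<in> carrier G - W"
    if "n \<in> carrier G" "conj_by n T = T" "g \<in> carrier G - W" for n g
    using that conj_W_iff[of n g] by (simp add: normalizer_T_def)
qed (use T mult_left_W_iff mult_right_W_iff in \<open>auto simp: subgroup_def\<close>)

end

subsection \<open>The group SL(2,q)\<close>

abbreviation mat2 :: "'a::zero \<Rightarrow> 'a \<Rightarrow> 'a \<Rightarrow> 'a \<Rightarrow> 'a ^ 2 ^ 2" where
  "mat2 a b c d \<equiv> vector [vector [a, b], vector [c, d]]"

lemma mat2_exhaust: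
  fixes g :: "'a::zero ^ 2 ^ 2"
  obtains a b c d where "g = mat2 a b c d"
proof
  show "g = mat2 (g $ 1 $ 1) (g $ 1 $ 2) (g $ 2 $ 1) (g $ 2 $ 2)"
    by (simp add: vec_eq_iff forall_2)
qed

lemma mat2_eq_iff: "mat2 a b c d = mat2 a' b' c' d' \<longleftrightarrow> a = a' \<and> b = b' \<and> c = c' \<and> d = d'"
  by (auto simp: vec_eq_iff forall_2)

lemma mat2_mult:
  fixes a :: "'a::semiring_1"
  shows "mat2 a b c d ** mat2 a' b' c' d' =
    mat2 (a * a' + b * c') (a * b' + b * d') (c * a' + d * c') (c * b' + d * d')"
  by (simp add: vec_eq_iff forall_2 matrix_matrix_mult_def sum_2)

lemma mat_1_eq_mat2: "mat 1 = mat2 1 0 0 1"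
  by (simp add: vec_eq_iff forall_2 mat_def)

text \<open>\<open>matrix_inv\<close> is a choice among two-sided inverses; \<open>B\<close> shows
  that one exists, and two-sided inverses are unique.\<close>

lemma matrix_inv_unique:
  fixes A B :: "'a::semiring_1 ^ 'n ^ 'n"
  assumes "A ** B = mat 1" "B ** A = mat 1"
  shows "matrix_inv A = B"
proof -
  have "A ** matrix_inv A = mat 1 \<and> matrix_inv A ** A = mat 1"
    unfolding matrix_inv_def by (rule someI[of _ B]) (simp add: assms)
  then show ?thesis
    by (metis assms(2) matrix_mul_assoc matrix_mul_lid matrix_mul_rid)
qed

lemma mat2_in_SL2: "mat2 a b c d \<in> carrier SL2 \<longleftrightarrow> a * d - b * c = 1"
  by (simp add: SL2_def det_2)

lemma SL2_simps [simp]: "x \<otimes>\<^bsub>SL2\<^esub> y = x ** y" "\<one>\<^bsub>SL2\<^esub> = mat 1"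
  by (simp_all add: SL2_def)

global_interpretation SL2: group "SL2 :: ('a::field ^ 2 ^ 2) monoid"
  by (rule group_SL2)

lemma r_coset_SL2: "X #>\<^bsub>SL2\<^esub> g = (\<lambda>x. x ** g) ` X"
  and l_coset_SL2: "g <#\<^bsub>SL2\<^esub> X = (\<lambda>x. g ** x) ` X"
  by (auto simp: r_coset_def l_coset_def)

lemma inv_SL2:
  fixes g :: "'a::field ^ 2 ^ 2"
  assumes "g \<in> carrier SL2"
  shows "inv\<^bsub>SL2\<^esub> g = matrix_inv g"
  by (rule matrix_inv_unique[symmetric]) (use SL2.r_inv[OF assms] SL2.l_inv[OF assms] in simp_all)

lemma inv_mat2:
  fixes a :: "'a::field"
  assumes "a * d - b * c = 1"
  shows "inv\<^bsub>SL2\<^esub> (mat2 a b c d) = mat2 d (- b) (- c) a"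
  using assms by (intro SL2.inv_equality) (auto simp: mat2_mult mat_1_eq_mat2 mat2_in_SL2 mat2_eq_iff algebra_simps)

lemma conj_by_SL2: "h \<in> carrier SL2 \<Longrightarrow> SL2.conj_by h X = conj_set h X"
  by (simp add: SL2.conj_by_def conj_set_def inv_SL2)

section \<open>The subgroup \<open>T\<close>, its normaliser and the order of SL(2,q)\<close>

lemma subgroup_T: "subgroup (T :: ('a::field ^ 2 ^ 2) set) SL2"
proof
  show "T \<subseteq> carrier (SL2 :: ('a ^ 2 ^ 2) monoid)"
    by (auto simp: T_def mat2_in_SL2)
  show "\<one>\<^bsub>SL2\<^esub> \<in> (T :: ('a ^ 2 ^ 2) set)"
    by (auto simp: T_def mat_1_eq_mat2)
  show "x \<otimes>\<^bsub>SL2\<^esub> y \<in> T" if "x \<in> T" "y \<in> T" for x y :: "'a ^ 2 ^ 2"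
    using that by (force simp: T_def mat2_mult)
  show "inv\<^bsub>SL2\<^esub> x \<in> T" if "x \<in> T" for x :: "'a ^ 2 ^ 2"
    using that by (force simp: T_def inv_mat2)
qed

lemma T_eq_range: "T = range (\<lambda>x. mat2 1 x 0 1)"
  by (auto simp: T_def)

lemma card_T: "card (T :: ('a::{field,finite} ^ 2 ^ 2) set) = CARD('a)"
  unfolding T_eq_range by (intro card_image injI) (simp add: mat2_eq_iff)

text \<open>The standard Borel subgroup, which is the normaliser of \<open>T\<close>.\<close>

definition upper_triangular :: "('a::field ^ 2 ^ 2) set" where
  "upper_triangular = {g \<in> carrier SL2. g $ 2 $ 1 = 0}"

text \<open>Conjugating the element of \<open>T\<close> with entry \<open>x\<close> produces the
  lower-left entry \<open>- c * x * c\<close>, so \<open>x = 1\<close> forces \<open>c = 0\<close>.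
  Conversely, \<open>c = 0\<close> makes \<open>d\<close> nonzero, and conjugation rescales
  \<open>x\<close> by \<open>d^2\<close>.\<close>

lemma conj_by_T_eq_iff:
  assumes "n \<in> carrier (SL2 :: ('a::field ^ 2 ^ 2) monoid)"
  shows "SL2.conj_by n T = T \<longleftrightarrow> n $ 2 $ 1 = 0"
proof -
  obtain a b c d where n: "n = mat2 a b c d" by (rule mat2_exhaust)
  have det: "a * d - b * c = 1" using assms by (simp add: n mat2_in_SL2)
  have conj: "inv\<^bsub>SL2\<^esub> n ** mat2 1 x 0 1 ** n =
      mat2 (1 + d * x * c) (d * x * d) (- c * x * c) (1 - c * x * d)" for x
    using det by (simp add: n inv_mat2 mat2_mult mat2_eq_iff algebra_simps)
  show ?thesis
  proof
    assume "SL2.conj_by n T = T"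
    moreover have "mat2 1 1 0 1 \<in> (T :: ('a ^ 2 ^ 2) set)" by (auto simp: T_def)
    ultimately have "inv\<^bsub>SL2\<^esub> n ** mat2 1 1 0 1 ** n \<in> T"
      by (force simp: SL2.conj_by_def)
    then have "- c * 1 * c = 0"
      unfolding conj by (auto simp: T_def mat2_eq_iff)
    then show "n $ 2 $ 1 = 0" by (simp add: n)
  next
    assume "n $ 2 $ 1 = 0"
    then have c: "c = 0" by (simp add: n)
    with det have d: "d \<noteq> 0" by auto
    have "SL2.conj_by n T = range (\<lambda>x. mat2 1 (d * x * d) 0 1)"
      unfolding SL2.conj_by_def SL2_simps T_eq_range image_image conj by (simp add: c)
    also have "\<dots> = T"
    proof (intro equalityI subsetI)
      fix g :: "'a ^ 2 ^ 2" assume "g \<in> T"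
      then obtain y where "g = mat2 1 y 0 1" by (auto simp: T_def)
      with d have "g = mat2 1 (d * (y / (d * d)) * d) 0 1" by (simp add: field_simps)
      then show "g \<in> range (\<lambda>x. mat2 1 (d * x * d) 0 1)" by blast
    qed (auto simp: T_def)
    finally show "SL2.conj_by n T = T" .
  qed
qed

lemma upper_triangular_eq: "upper_triangular = {mat2 a b 0 (inverse a) | a b. a \<noteq> 0}"
proof (intro equalityI subsetI)
  fix g :: "'a ^ 2 ^ 2" assume g: "g \<in> upper_triangular"
  obtain a b c d where abcd: "g = mat2 a b c d" by (rule mat2_exhaust)
  with g have "c = 0" "a * d = 1" by (auto simp: upper_triangular_def mat2_in_SL2)
  moreover from this have "d = inverse a" by (metis inverse_unique)
  moreover from \<open>a * d = 1\<close> have "a \<noteq> 0" by auto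
  ultimately show "g \<in> {mat2 a b 0 (inverse a) | a b. a \<noteq> 0}" using abcd by blast
qed (auto simp: upper_triangular_def mat2_in_SL2)

lemma card_upper_triangular:
  "card (upper_triangular :: ('a::{field,finite} ^ 2 ^ 2) set) = (CARD('a) - 1) * CARD('a)"
proof -
  let ?f = "\<lambda>(a :: 'a, b). mat2 a b 0 (inverse a)"
    and ?D = "(UNIV - {0 :: 'a}) \<times> (UNIV :: 'a set)"
  have eq: "upper_triangular = ?f ` ?D"
    by (auto simp: upper_triangular_eq)
  have "inj_on ?f ?D"
    by (auto intro!: inj_onI simp: mat2_eq_iff)
  then have "card (upper_triangular :: ('a ^ 2 ^ 2) set) = card ?D"
    unfolding eq by (rule card_image)
  then show ?thesis
    by (simp add: card_cartesian_product card_Diff_singleton)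
qed

text \<open>Upper triangular elements normalise \<open>T\<close>. This covers the elements of
  \<open>Omega\<close> with lower-left entry 0, which conjugation by \<open>diag(1, v)\<close>
  leaves in \<open>Omega\<close>.\<close>

lemma upper_triangular_coset:
  fixes g :: "'a::field ^ 2 ^ 2"
  assumes "g \<in> upper_triangular"
  shows "T #>\<^bsub>SL2\<^esub> g = g <#\<^bsub>SL2\<^esub> T"
proof -
  have T: "(T :: ('a ^ 2 ^ 2) set) \<subseteq> carrier SL2"
    by (rule subgroup.subset[OF subgroup_T])
  have g: "g \<in> carrier SL2" "SL2.conj_by g T = T"
    using assms by (auto simp: upper_triangular_def conj_by_T_eq_iff)
  let ?g = "inv\<^bsub>SL2\<^esub> g"
  have "SL2.conj_by ?g T = T"
    using SL2.conj_by_inv_cancel(1)[OF T g(1)] unfolding g(2) .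
  then have "SL2.conj_by ?g (T #>\<^bsub>SL2\<^esub> g) = T #>\<^bsub>SL2\<^esub> g"
    using SL2.conj_by_r_coset[OF T g(1) SL2.inv_closed[OF g(1)]] g(1)
    by (simp add: SL2.m_assoc del: SL2_simps)
  then show ?thesis
    unfolding SL2.l_coset_eq_conj_by[OF T g(1)] by (rule sym)
qed

text \<open>Off the Borel subgroup \<open>c\<close> is nonzero and determines \<open>b\<close> from
  \<open>a\<close> and \<open>d\<close>, giving q(q-1)q matrices; the Borel subgroup adds
  (q-1)q.\<close>

lemma order_SL2: "order (SL2 :: ('a::{field,finite} ^ 2 ^ 2) monoid) = CARD('a) * (CARD('a) ^ 2 - 1)"
proof -
  define f where "f = (\<lambda>(a :: 'a, c, d). mat2 a ((a * d - 1) / c) c d)"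
  let ?D = "UNIV \<times> (UNIV - {0}) \<times> UNIV"
  have "carrier SL2 - upper_triangular = f ` ?D"
  proof (intro equalityI subsetI)
    fix g :: "'a ^ 2 ^ 2" assume g: "g \<in> carrier SL2 - upper_triangular"
    obtain a b c d where abcd: "g = mat2 a b c d" by (rule mat2_exhaust)
    with g have "c \<noteq> 0" "a * d - b * c = 1" by (auto simp: upper_triangular_def mat2_in_SL2)
    moreover from this have "b = (a * d - 1) / c" by (simp add: field_simps)
    ultimately have "g = f (a, c, d)" "(a, c, d) \<in> ?D" by (simp_all add: f_def abcd)
    then show "g \<in> f ` ?D" by blast
  qed (auto simp: f_def upper_triangular_def mat2_in_SL2)
  moreover have "inj_on f ?D"
    by (auto intro!: inj_onI simp: f_def mat2_eq_iff)
  ultimately have "card (carrier SL2 - (upper_triangular :: ('a ^ 2 ^ 2) set)) = CARD('a) * ((CARD('a) - 1) * CARD('a))"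
    by (simp add: card_image card_cartesian_product card_Diff_singleton)
  moreover have "upper_triangular \<subseteq> carrier (SL2 :: ('a ^ 2 ^ 2) monoid)"
    by (auto simp: upper_triangular_def)
  ultimately have "order (SL2 :: ('a ^ 2 ^ 2) monoid) = CARD('a) * ((CARD('a) - 1) * CARD('a)) + (CARD('a) - 1) * CARD('a)"
    unfolding order_def card_upper_triangular[symmetric]
    \<comment> \<open>The bound lets the truncated subtraction in the cardinality of the difference
      be undone.\<close>
    using card_mono[of "carrier SL2" "upper_triangular :: ('a ^ 2 ^ 2) set"]
    by (simp add: card_Diff_subset)
  also have "\<dots> = CARD('a) * (CARD('a) ^ 2 - 1)"
    by (cases "CARD('a)") (auto simp: power2_eq_square algebra_simps)
  finally show ?thesis .
qed

text \<open>The order is q(q^2 - 1), and \<open>p\<close> divides q^2, hence not q^2 - 1; so the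
  \<open>p\<close>-part of the order is exactly q.\<close>

lemma T_sylow:
  assumes "prime p" "CARD('a::{field,finite}) = p ^ k" "k \<ge> 1"
  shows "(T :: ('a ^ 2 ^ 2) set) \<in> sylow_subgroups p SL2"
proof -
  have "p ^ k > 1" using assms by (intro one_less_power prime_gt_1_nat) auto
  have "p > 0" using assms by (simp add: prime_gt_0_nat)
  then have q: "(p ^ k) ^ 2 \<ge> 1" "p ^ k > 0"
    using \<open>p > 0\<close> by (auto simp: Suc_le_eq)
  have "multiplicity p (order (SL2 :: ('a ^ 2 ^ 2) monoid)) = k"
  proof (rule multiplicity_eqI)
    show "p ^ k dvd order (SL2 :: ('a ^ 2 ^ 2) monoid)"
      by (simp add: order_SL2 assms)
    show "\<not> p ^ Suc k dvd order (SL2 :: ('a ^ 2 ^ 2) monoid)"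
    proof
      assume "p ^ Suc k dvd order (SL2 :: ('a ^ 2 ^ 2) monoid)"
      then have "p ^ k * p dvd p ^ k * ((p ^ k) ^ 2 - 1)"
        by (simp add: order_SL2 assms mult.commute)
      then have "p dvd (p ^ k) ^ 2 - 1"
        using q by (metis dvd_times_left_cancel_iff not_gr_zero)
      moreover have "p dvd (p ^ k) ^ 2"
        unfolding power_mult[symmetric] using assms(3) by (intro dvd_power) auto
      ultimately have "p dvd (p ^ k) ^ 2 - ((p ^ k) ^ 2 - 1)"
        by (rule dvd_diff_nat[rotated])
      then have "p dvd 1" unfolding diff_diff_cancel[OF q(1)] .
      then show False using assms(1) not_prime_unit by blast
    qed
  qed
  then show ?thesis
    by (simp add: sylow_subgroups_def subgroup_T card_T assms)
qed

section \<open>Squares in a finite field\<close>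

lemma squares_mult: "x \<in> squares \<Longrightarrow> y \<in> squares \<Longrightarrow> x * y \<in> squares"
  unfolding squares_def by (auto simp flip: power_mult_distrib)

lemma power2_in_squares: "x ^ 2 \<in> squares" "x * x \<in> squares"
  unfolding squares_def by (auto simp flip: power2_eq_square)

lemma squares_inverse:
  assumes "x \<in> squares" shows "inverse x \<in> squares"
proof -
  from assms obtain y where "x = y ^ 2" by (auto simp: squares_def)
  then have "inverse x = (inverse y) ^ 2" by (simp add: power_inverse)
  then show ?thesis by (auto simp: squares_def)
qed

lemma squares_divide: "x \<in> squares \<Longrightarrow> y \<in> squares \<Longrightarrow> x / y \<in> squares"
  by (simp add: divide_inverse squares_mult squares_inverse)

text \<open>A square \<open>z^2\<close> has only the roots \<open>z\<close> and \<open>-z\<close>,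
  so squaring maps the units at most two-to-one onto the nonzero squares.\<close>

lemma card_nonzero_squares_ge:
  "CARD('a::{field,finite}) - 1 \<le> 2 * card (squares - {0 :: 'a})"
proof -
  let ?S = "squares - {0 :: 'a}"
  have "card {y :: 'a. y ^ 2 = s} \<le> 2" for s
  proof (cases "\<exists>z. s = z ^ 2")
    case True
    then obtain z where "s = z ^ 2" by blast
    then have "{y. y ^ 2 = s} \<subseteq> {z, - z}" by (auto simp: power2_eq_iff)
    then have "card {y. y ^ 2 = s} \<le> card {z, - z}" by (intro card_mono) auto
    also have "\<dots> \<le> 2" by (simp add: card_insert_if)
    finally show ?thesis .
  next
    case False
    then have "{y. y ^ 2 = s} = {}" by auto
    then show ?thesis by simp
  qed
  then have "(\<Sum>s\<in>?S. card {y :: 'a. y ^ 2 = s}) \<le> (\<Sum>s\<in>?S. 2)"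
    by (intro sum_mono)
  moreover have "card (\<Union>s\<in>?S. {y :: 'a. y ^ 2 = s}) \<le> (\<Sum>s\<in>?S. card {y :: 'a. y ^ 2 = s})"
    by (intro card_UN_le) simp
  moreover have "UNIV - {0 :: 'a} = (\<Union>s\<in>?S. {y :: 'a. y ^ 2 = s})"
    by (auto simp: squares_def)
  moreover have "card (UNIV - {0 :: 'a}) = CARD('a) - 1"
    by (simp add: card_Diff_singleton)
  ultimately show ?thesis by simp
qed

lemma nonsquare_divide_nonsquare:
  fixes x v :: "'a::{field,finite}"
  assumes "x \<notin> squares" "v \<notin> squares"
  shows "x / v \<in> squares"
proof -
  let ?S = "squares - {0 :: 'a}"
  have [simp]: "0 \<in> (squares :: 'a set)" using power2_in_squares[of 0] by simp
  have nz: "v \<noteq> 0" "x \<noteq> 0" using assms by auto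
  \<comment> \<open>\<open>S\<close> and its translate \<open>vS\<close> are disjoint, and \<open>S\<close> contains at least half of the units.\<close>
  have disj: "?S \<inter> (*) v ` ?S = {}"
  proof -
    have False if "s \<in> ?S" "v * s \<in> squares" for s
      using squares_divide[OF that(2), of s] that assms(2) by simp
    then show ?thesis by blast
  qed
  have "card ((*) v ` ?S) = card ?S"
    using nz by (intro card_image inj_onI) simp
  with disj have "card (?S \<union> (*) v ` ?S) = 2 * card ?S"
    by (simp add: card_Un_disjoint)
  with card_nonzero_squares_ge[where ?'a = 'a]
  have "card (UNIV - {0 :: 'a}) \<le> card (?S \<union> (*) v ` ?S)"
    by (simp add: card_Diff_singleton)
  \<comment> \<open>The count leaves no further units, so a unit that is not a square must lie in
    the translate.\<close>
  then have "?S \<union> (*) v ` ?S = UNIV - {0}"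
    using nz by (intro card_seteq) auto
  with nz assms(1) have "x \<in> (*) v ` ?S" by blast
  with nz show ?thesis by auto
qed

section \<open>The two parallelisms\<close>

lemma twisted_cosets_Omega: "twisted_cosets SL2 T (Omega :: ('a::field ^ 2 ^ 2) set)"
proof (intro twisted_cosets.intro twisted_cosets_axioms.intro group_SL2 subgroup_T)
  show "inv\<^bsub>SL2\<^esub> n \<otimes>\<^bsub>SL2\<^esub> g \<otimes>\<^bsub>SL2\<^esub> n \<in> Omega"
    if n: "n \<in> carrier SL2" "SL2.conj_by n T = T" and g: "g \<in> Omega" for n g :: "'a ^ 2 ^ 2"
  proof -
    from n have "n \<in> upper_triangular"
      using conj_by_T_eq_iff[of n] by (simp add: upper_triangular_def)
    then obtain a b where ab: "n = mat2 a b 0 (inverse a)" "a \<noteq> 0"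
      by (auto simp: upper_triangular_eq)
    obtain a' b' c d where abcd: "g = mat2 a' b' c d" by (rule mat2_exhaust)
    \<comment> \<open>The second row of the inverse of \<open>n\<close> is (0, a) and the first
      column of \<open>n\<close> is (a, 0).\<close>
    have "(inv\<^bsub>SL2\<^esub> n ** g ** n) $ 2 $ 1 = c * (a * a)"
      using ab by (simp add: inv_mat2 abcd mat2_mult algebra_simps)
    moreover have "c * (a * a) \<in> squares"
      using g abcd by (intro squares_mult power2_in_squares) (simp add: Omega_def)
    moreover have "inv\<^bsub>SL2\<^esub> n \<otimes>\<^bsub>SL2\<^esub> g \<otimes>\<^bsub>SL2\<^esub> n \<in> carrier SL2"
      using n g by (intro SL2.m_closed SL2.inv_closed) (auto simp: Omega_def)
    ultimately show ?thesis by (simp add: Omega_def)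
  qed
next
  fix t g :: "'a ^ 2 ^ 2"
  assume t: "t \<in> T" and g: "g \<in> Omega"
  obtain a b c d where abcd: "g = mat2 a b c d" by (rule mat2_exhaust)
  \<comment> \<open>Left multiplication by \<open>t\<close> keeps the second row of
    \<open>g\<close>, right multiplication the first column.\<close>
  from t have "(t ** g) $ 2 $ 1 = c" "(g ** t) $ 2 $ 1 = c"
    by (auto simp: T_def abcd mat2_mult)
  moreover have "c \<in> squares" using g abcd by (simp add: Omega_def)
  moreover have "t \<otimes>\<^bsub>SL2\<^esub> g \<in> carrier SL2" "g \<otimes>\<^bsub>SL2\<^esub> t \<in> carrier SL2"
    using t g subgroup.subset[OF subgroup_T] by (auto simp: Omega_def simp del: SL2_simps intro!: SL2.m_closed)
  ultimately show "t \<otimes>\<^bsub>SL2\<^esub> g \<in> Omega" "g \<otimes>\<^bsub>SL2\<^esub> t \<in> Omega"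
    by (simp_all add: Omega_def)
qed (auto simp: Omega_def)

lemma Omega_eq: "carrier SL2 - Omega_c = Omega"
  by (auto simp: Omega_c_def Omega_def)

lemma twisted_cosets_Omega_c: "twisted_cosets SL2 T (Omega_c :: ('a::field ^ 2 ^ 2) set)"
  unfolding Omega_c_def by (rule twisted_cosets.twisted_cosets_complement[OF twisted_cosets_Omega])

lemma base_class_Omega: "twisted_cosets.base_class SL2 T Omega = A_odd"
  unfolding twisted_cosets.base_class_def[OF twisted_cosets_Omega] A_odd_def Omega_c_def ..

lemma base_class_Omega_c: "twisted_cosets.base_class SL2 T Omega_c = A'_odd"
  unfolding twisted_cosets.base_class_def[OF twisted_cosets_Omega_c] A'_odd_def Omega_eq ..

lemma parallel_classes_SL2:
  assumes "twisted_cosets SL2 T W"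
  shows "twisted_cosets.parallel_classes SL2 T W =
    {conj_set h ` twisted_cosets.base_class SL2 T W | h. h \<in> carrier SL2}"
  unfolding twisted_cosets.parallel_classes_def[OF assms]
  by (intro Collect_cong ex_cong1) (auto simp: conj_by_SL2 image_iff)

lemma parallel_classes_Omega: "twisted_cosets.parallel_classes SL2 T Omega = pi_odd"
  by (simp add: parallel_classes_SL2 twisted_cosets_Omega base_class_Omega pi_odd_def)

lemma parallel_classes_Omega_c: "twisted_cosets.parallel_classes SL2 T Omega_c = pi'_odd"
  by (simp add: parallel_classes_SL2 twisted_cosets_Omega_c base_class_Omega_c pi'_odd_def)

lemma card_base_class_SL2:
  fixes W :: "('a::{field,finite} ^ 2 ^ 2) set"
  assumes "twisted_cosets SL2 T W"
  shows "card (twisted_cosets.base_class SL2 T W) = CARD('a) ^ 2 - 1"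
  using twisted_cosets.card_base_class[OF assms] by (simp add: card_T order_SL2)

text \<open>The number of classes is the index of the Borel subgroup, q(q^2 - 1) / (q(q-1)) = q + 1;
  each class has as many blocks as \<open>T\<close> has cosets, q^2 - 1.\<close>

lemma parallelism_on_parallel_classes:
  fixes W :: "('a::{field,finite} ^ 2 ^ 2) set"
  assumes p: "prime p" "CARD('a) = p ^ k" "k \<ge> 1"
    and tw: "twisted_cosets SL2 T W"
  shows "parallelism_on CARD('a) (sylow_cosets p SL2) (twisted_cosets.parallel_classes SL2 T W)"
proof -
  interpret twisted_cosets SL2 T W by (fact tw)
  have q: "CARD('a) > 1"
    unfolding p(2) using p(1,3) by (intro one_less_power prime_gt_1_nat) auto
  have "normalizer_T = upper_triangular"
    unfolding normalizer_T_def upper_triangular_def using conj_by_T_eq_iff by blast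
  with card_classes have "card parallel_classes * ((CARD('a) - 1) * CARD('a)) = CARD('a) * (CARD('a) ^ 2 - 1)"
    by (simp add: card_upper_triangular order_SL2)
  also have "\<dots> = (CARD('a) + 1) * ((CARD('a) - 1) * CARD('a))"
    by (cases "CARD('a)") (auto simp: power2_eq_square algebra_simps)
  finally have "card parallel_classes = CARD('a) + 1"
    using q by (simp only: mult_cancel2) auto
  moreover have "sylow_cosets p SL2 = coset_set"
    unfolding coset_set_def
    by (rule SL2.sylow_cosets_eq_conj_by[OF _ p(1) T_sylow[OF p]]) simp
  ultimately show ?thesis
    unfolding parallelism_on_def
    using partition_on_classes card_class disjoint_class card_base_class_SL2[OF tw] by simp
qed

section \<open>Conjugation by \<open>diag(1, v)\<close>\<close>

lemma conj_set_diag: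
  fixes v :: "'a::field"
  assumes "v \<noteq> 0" and f: "f = mat2 1 0 0 v"
  shows matrix_inv_diag: "matrix_inv f = mat2 1 0 0 (inverse v)"
    and "f ** matrix_inv f = mat 1" "matrix_inv f ** f = mat 1"
proof -
  have "f ** mat2 1 0 0 (inverse v) = mat 1" "mat2 1 0 0 (inverse v) ** f = mat 1"
    using assms by (simp_all add: mat2_mult mat_1_eq_mat2)
  then show "matrix_inv f = mat2 1 0 0 (inverse v)"
      "f ** matrix_inv f = mat 1" "matrix_inv f ** f = mat 1"
    by (auto simp: matrix_inv_unique)
qed

context
  fixes v :: "'a::{field,finite}" and f \<phi>
  assumes v: "v \<notin> squares" and f: "f = mat2 1 0 0 v"
  defines "\<phi> \<equiv> \<lambda>g. matrix_inv f ** g ** f"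
begin

lemma nonsquare_nonzero: "v \<noteq> 0"
  using v power2_in_squares[of "0 :: 'a"] by auto

lemma phi_mat2: "\<phi> (mat2 a b c d) = mat2 a (b * v) (c / v) d"
proof -
  have "\<phi> (mat2 a b c d) = mat2 1 0 0 (inverse v) ** mat2 a b c d ** f"
    unfolding \<phi>_def matrix_inv_diag[OF nonsquare_nonzero f] ..
  then show ?thesis
    unfolding f using nonsquare_nonzero by (simp add: mat2_mult field_simps)
qed

lemma phi_mult: "\<phi> (x ** y) = \<phi> x ** \<phi> y"
proof -
  have "\<phi> x ** \<phi> y = matrix_inv f ** x ** (f ** matrix_inv f) ** y ** f"
    by (simp add: \<phi>_def matrix_mul_assoc)
  also have "\<dots> = \<phi> (x ** y)"
    unfolding conj_set_diag(2)[OF nonsquare_nonzero f] by (simp add: \<phi>_def matrix_mul_assoc)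
  finally show ?thesis ..
qed

lemma inj_phi: "inj \<phi>"
proof (rule injI)
  fix x y assume "\<phi> x = \<phi> y"
  moreover obtain a b c d where "x = mat2 a b c d" by (rule mat2_exhaust)
  moreover obtain a' b' c' d' where "y = mat2 a' b' c' d'" by (rule mat2_exhaust)
  ultimately show "x = y" using nonsquare_nonzero by (simp add: phi_mat2 mat2_eq_iff)
qed

lemma phi_SL2: "g \<in> carrier SL2 \<Longrightarrow> \<phi> g \<in> carrier SL2"
  by (rule mat2_exhaust[of g]) (use nonsquare_nonzero in \<open>simp add: phi_mat2 mat2_in_SL2\<close>)

text \<open>An injective self-map of a finite set is onto.\<close>

lemma phi_image_SL2: "\<phi> ` carrier SL2 = carrier SL2"
  by (rule endo_inj_surj) (use phi_SL2 inj_phi in \<open>auto intro: inj_on_subset\<close>)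

lemma phi_image_T: "\<phi> ` T = T"
  by (rule endo_inj_surj) (use inj_phi in \<open>auto intro: inj_on_subset simp: T_def phi_mat2\<close>)

text \<open>The lower-left entry is divided by \<open>v\<close>, and a quotient of two non-squares
  of a finite field is a square.\<close>

lemma phi_Omega_c: "g \<in> Omega_c \<Longrightarrow> \<phi> g \<in> Omega"
  by (rule mat2_exhaust[of g])
    (use phi_SL2[of g] v nonsquare_divide_nonsquare in \<open>auto simp: phi_mat2 Omega_def Omega_c_def\<close>)

text \<open>Dividing a nonzero square by \<open>v\<close> gives a non-square. The entry 0 stays 0,
  which is the exceptional upper triangular case.\<close>

lemma phi_Omega:
  assumes "g \<in> Omega"
  shows "\<phi> g \<in> Omega_c \<or> \<phi> g \<in> Omega \<and> \<phi> g \<in> upper_triangular"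
proof -
  obtain a b c d where g: "g = mat2 a b c d" by (rule mat2_exhaust)
  have SL: "\<phi> g \<in> carrier SL2" and c: "c \<in> squares"
    using assms phi_SL2 by (auto simp: Omega_def g)
  show ?thesis
  proof (cases "c = 0")
    case True
    with SL c show ?thesis by (simp add: Omega_def upper_triangular_def phi_mat2 g)
  next
    case False
    \<comment> \<open>Otherwise \<open>v = c / (c / v)\<close> would be a quotient of
      squares.\<close>
    have "c / v \<notin> squares"
      using squares_divide[OF c, of "c / v"] False v nonsquare_nonzero by auto
    with SL show ?thesis by (simp add: Omega_c_def Omega_def phi_mat2 g)
  qed
qed

lemma conj_set_r_coset: "conj_set f (T #>\<^bsub>SL2\<^esub> g) = T #>\<^bsub>SL2\<^esub> \<phi> g"
proof -
  have "conj_set f (T #>\<^bsub>SL2\<^esub> g) = (\<lambda>t. t ** \<phi> g) ` \<phi> ` T"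
    unfolding conj_set_def \<phi>_def[symmetric] r_coset_SL2 image_image phi_mult ..
  then show ?thesis unfolding phi_image_T r_coset_SL2 .
qed

lemma conj_set_l_coset: "conj_set f (g <#\<^bsub>SL2\<^esub> T) = \<phi> g <#\<^bsub>SL2\<^esub> T"
proof -
  have "conj_set f (g <#\<^bsub>SL2\<^esub> T) = (\<lambda>t. \<phi> g ** t) ` \<phi> ` T"
    unfolding conj_set_def \<phi>_def[symmetric] l_coset_SL2 image_image phi_mult ..
  then show ?thesis unfolding phi_image_T l_coset_SL2 .
qed

text \<open>One inclusion suffices, since both base classes have q^2 - 1 blocks and conjugation is
  injective.\<close>

lemma conj_set_image_A_odd: "conj_set f ` A_odd = A'_odd"
proof (rule card_subset_eq)
  show "conj_set f ` A_odd \<subseteq> A'_odd"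
  proof (rule image_subsetI)
    fix X :: "('a ^ 2 ^ 2) set" assume "X \<in> A_odd"
    then consider g where "g \<in> Omega" "X = T #>\<^bsub>SL2\<^esub> g"
      | g where "g \<in> Omega_c" "X = g <#\<^bsub>SL2\<^esub> T"
      by (auto simp: A_odd_def)
    then show "conj_set f X \<in> A'_odd"
    proof cases
      case 1
      \<comment> \<open>If \<open>\<phi> g\<close> stays in \<open>Omega\<close>, it is upper
        triangular, and its right coset is the left coset that \<open>A'_odd\<close>
        contains.\<close>
      from phi_Omega[OF 1(1)] show ?thesis
        using upper_triangular_coset unfolding 1(2) conj_set_r_coset A'_odd_def by blast
    next
      case 2
      from phi_Omega_c[OF 2(1)] show ?thesis
        unfolding 2(2) conj_set_l_coset A'_odd_def by blast
    qed
  qed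
  have "inj (conj_set f)"
    unfolding conj_set_def \<phi>_def[symmetric] by (rule injI) (simp add: inj_image_eq_iff inj_phi)
  then have "card (conj_set f ` A_odd) = card (A_odd :: ('a ^ 2 ^ 2) set set)"
    by (intro card_image) (rule inj_on_subset, auto)
  also have "\<dots> = card (A'_odd :: ('a ^ 2 ^ 2) set set)"
    using card_base_class_SL2[where ?'a = 'a, OF twisted_cosets_Omega]
      card_base_class_SL2[where ?'a = 'a, OF twisted_cosets_Omega_c]
    unfolding base_class_Omega base_class_Omega_c by simp
  finally show "card (conj_set f ` A_odd) = card (A'_odd :: ('a ^ 2 ^ 2) set set)" .
qed simp

text \<open>\<open>\<phi>\<close> is multiplicative and fixes the identity, so it sends the inverse
  of \<open>h\<close> to that of \<open>\<phi> h\<close>.\<close>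

lemma conj_set_commute:
  fixes X :: "('a ^ 2 ^ 2) set"
  assumes "h \<in> carrier SL2"
  shows "conj_set f (conj_set h X) = conj_set (\<phi> h) (conj_set f X)"
proof -
  have "\<phi> (mat 1) = mat 1"
    by (simp add: mat_1_eq_mat2 phi_mat2)
  then have "matrix_inv (\<phi> h) = \<phi> (matrix_inv h)"
    using SL2.r_inv[OF assms] SL2.l_inv[OF assms] assms
    by (intro matrix_inv_unique) (simp_all add: inv_SL2 flip: phi_mult)
  then show ?thesis
    unfolding conj_set_def \<phi>_def[symmetric] image_image by (simp add: phi_mult)
qed

text \<open>The conjugate of \<open>A_odd\<close> by \<open>h\<close> goes to the conjugate of
  \<open>A'_odd\<close> by \<open>\<phi> h\<close>, and \<open>\<phi>\<close> permutes
  SL(2,q).\<close>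

lemma conj_set_image_pi_odd: "{conj_set f ` B | B. B \<in> pi_odd} = pi'_odd"
proof -
  have "{conj_set f ` B | B. B \<in> pi_odd} = (\<lambda>h. conj_set f ` conj_set h ` A_odd) ` carrier SL2"
    unfolding pi_odd_def by blast
  also have "\<dots> = (\<lambda>h. conj_set (\<phi> h) ` A'_odd) ` carrier SL2"
    unfolding conj_set_image_A_odd[symmetric] image_image
    by (intro image_cong refl) (simp add: conj_set_commute)
  also have "\<dots> = (\<lambda>h. conj_set h ` A'_odd) ` \<phi> ` carrier SL2"
    by (simp add: image_image)
  also have "\<dots> = pi'_odd"
    unfolding phi_image_SL2 pi'_odd_def by blast
  finally show ?thesis .
qed

end

theorem mainTheorem1:
  fixes p k q :: nat
  assumes "prime p" and "k \<ge> 1" and "q = p ^ k" and "odd q"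
    and "CARD('a::{field,finite}) = q"
  shows "parallelism_on q (sylow_cosets p SL2) (pi_odd :: ('a ^ 2 ^ 2) set set set)
    \<and> parallelism_on q (sylow_cosets p SL2) (pi'_odd :: ('a ^ 2 ^ 2) set set set)
    \<and> (\<forall>(v::'a) f. v \<noteq> 0 \<and> v \<notin> squares \<and> f = vector [vector [1, 0], vector [0, v]]
          \<longrightarrow> {conj_set f ` B | B. B \<in> pi_odd} = (pi'_odd :: ('a ^ 2 ^ 2) set set set))"
proof -
  note parallelism = parallelism_on_parallel_classes[where ?'a = 'a, OF assms(1) _ assms(2)]
  show ?thesis
    using parallelism[OF _ twisted_cosets_Omega] parallelism[OF _ twisted_cosets_Omega_c]
      conj_set_image_pi_odd[where ?'a = 'a, OF _ refl] assms(3,5)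
    by (simp add: parallel_classes_Omega parallel_classes_Omega_c)
qed

end
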